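(* Let $n\ge 3$ and consider the cycle graph on nodes $1,\dots,n$ with arbitrary measurements $\widetilde{R}_{12},\dots,\widetilde{R}_{n-1,n},\widetilde{R}_{n1}\in\mathrm{SO}(3)$. Then the point $R^\ast=(R_1^\ast,\dots,R_n^\ast)$ with $R_1^\ast=I_3$ and $$R_i^\ast=\Big(\prod_{s=1}^{i-1}\widetilde{R}_{s,s+1}\Big)^{\top}E_0^{\,i-1},\qquad i\in\{2,\dots,n\},$$ (product from left to right, i.e. $\widetilde{R}_{12}\cdots\widetilde{R}_{i-1,i}$) is a global minimizer of $f$ over $\mathrm{SO}(3)^n$.
   Context: Cycle-graph rotation averaging setup. Let $n\ge 3$. The cycle graph has nodes $1,\dots,n$ and edges $\{i,i+1\}$ for $i=1,\dots,n-1$ together with $\{n,1\}$; write $i\sim j$ if $\{i,j\}$ is an edge. Each edge carries a measured rotation $\widetilde{R}_{ij}\in\mathrm{SO}(3)$, with the convention $\widetilde{R}_{ji}=\widetilde{R}_{ij}^\top$. Define the symmetric $3n\times 3n$ block matrix $\widetilde{R}$ whose $(i,j)$ $3\times3$ block is $I_3$ if $i=j$, $\widetilde{R}_{ij}$ if $i\sim j$, and $0$ otherwise. For $R=(R_1,\dots,R_n)\in\mathrm{SO}(3)^n$, write $R=[R_1^\top\ \cdots\ R_n^\top]^\top\in\mathbb{R}^{3n\times 3}$ and define $f(R):=-\operatorname{Tr}(R^\top\widetilde{R}R)$; the rotation averaging problem is to minimize $f$ over $\mathrm{SO}(3)^n$. The cycle error is $E:=\widetilde{R}_{12}\widetilde{R}_{23}\cdots\widetilde{R}_{n-1,n}\widetilde{R}_{n1}\in\mathrm{SO}(3)$.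 Write $E=\exp(\gamma[\hat n]_\times)$ with unit axis $\hat n$ and angle $\gamma=\angle(E)\in[-\pi,\pi]$. For $k\in\{0,\dots,n-1\}$, $E_k:=\exp\big((\gamma/n-2k\pi/n)[\hat n]_\times\big)$; in particular $E_0=\exp((\gamma/n)[\hat n]_\times)$. *)

theory Defs
  imports "HOL-Analysis.Analysis"
begin

type_synonym mat3 = "real^3^3"

text \<open>SO(3): orthogonal 3x3 matrices with determinant 1.\<close>
definition SO3 :: "mat3 set" where
  "SO3 = {A. orthogonal_matrix A \<and> det A = 1}"

text \<open>Matrix powers and the matrix exponential (power series).\<close>
fun mpow :: "mat3 \<Rightarrow> nat \<Rightarrow> mat3" where
  "mpow A 0 = mat 1"
| "mpow A (Suc k) = A ** mpow A k"

definition mexp :: "mat3 \<Rightarrow> mat3" where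
  "mexp A = (\<Sum>k. (1 / fact k) *\<^sub>R mpow A k)"

text \<open>Skew-symmetric cross-product matrix [v]_x.\<close>
definition skew :: "real^3 \<Rightarrow> mat3" where
  "skew v = vector [vector [0, - (v$3), v$2],
                    vector [v$3, 0, - (v$1)],
                    vector [- (v$2), v$1, 0]]"

text \<open>Cycle graph on nodes 1..n: edges {i,i+1} (i<n) and {n,1}.\<close>
definition cyc_adj :: "nat \<Rightarrow> nat \<Rightarrow> nat \<Rightarrow> bool" where
  "cyc_adj n i j \<longleftrightarrow> i \<in> {1..n} \<and> j \<in> {1..n} \<and>
     ((j = i + 1) \<or> (i = j + 1) \<or> (i = n \<and> j = 1) \<or> (i = 1 \<and> j = n))"

text \<open>Measurements: Rt i = R~_{i,i+1} for 1 \<le> i < n, and Rt n = R~_{n,1}.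
  The measurement on an ordered pair (i,j), with R~_{ji} = R~_{ij}^T.\<close>
definition meas :: "nat \<Rightarrow> (nat \<Rightarrow> mat3) \<Rightarrow> nat \<Rightarrow> nat \<Rightarrow> mat3" where
  "meas n Rt i j =
     (if j = i + 1 then Rt i
      else if i = j + 1 then transpose (Rt j)
      else if i = n \<and> j = 1 then Rt n
      else transpose (Rt n))"

text \<open>(i,j) 3x3 block of the 3n x 3n data matrix R~.\<close>
definition block :: "nat \<Rightarrow> (nat \<Rightarrow> mat3) \<Rightarrow> nat \<Rightarrow> nat \<Rightarrow> mat3" where
  "block n Rt i j = (if i = j then mat 1 else if cyc_adj n i j then meas n Rt i j else 0)"

text \<open>f(R) = - Tr(R^T R~ R), written blockwise.\<close>
definition cost :: "nat \<Rightarrow> (nat \<Rightarrow> mat3) \<Rightarrow> (nat \<Rightarrow> mat3) \<Rightarrow> real" where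
  "cost n Rt R = - (\<Sum>i\<in>{1..n}. \<Sum>j\<in>{1..n}.
       trace (transpose (R i) ** block n Rt i j ** R j))"

text \<open>Ordered product Rt 1 ** Rt 2 ** ... ** Rt k.\<close>
fun mprod :: "(nat \<Rightarrow> mat3) \<Rightarrow> nat \<Rightarrow> mat3" where
  "mprod Rt 0 = mat 1"
| "mprod Rt (Suc k) = mprod Rt k ** Rt (Suc k)"

text \<open>Cycle error E = R~_12 R~_23 ... R~_{n-1,n} R~_{n1}.\<close>
definition cycle_err :: "nat \<Rightarrow> (nat \<Rightarrow> mat3) \<Rightarrow> mat3" where
  "cycle_err n Rt = mprod Rt n"

end

theory Submission
  imports Defs
begin

text \<open>Let Q_i = R_i^T R~_(i,i+1) R_(i+1) be the residual rotation on edge i, so that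
  f(R) = -3n - 2 sum_i tr Q_i and tr Q_i = 1 + 2 cos theta(Q_i), theta the rotation angle.
  Around the cycle the residuals multiply to a conjugate of the cycle error E, and theta is
  subadditive: since min over unit v of v.Av is cos theta(A), subadditivity is the triangle
  inequality for angles on the sphere. Hence sum_i theta(Q_i) >= |gamma|, and under this
  constraint sum_i cos theta(Q_i) <= n cos (gamma/n), which bounds f from below. By Rodrigues'
  formula every residual of R* equals E_0, so R* attains the bound.\<close>

section \<open>Matrices and SO(3)\<close>

lemma matrix_add_rdistrib: "((A::'a::semiring_1^'n^'m) + B) ** C = A ** C + B ** C"
  by (simp add: matrix_matrix_mult_def vec_eq_iff distrib_right sum.distrib)

lemma matrix_diff_ldistrib: "(A::'a::ring_1^'n^'m) ** (B - C) = A ** B - A ** C"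
  by (simp add: matrix_matrix_mult_def vec_eq_iff right_diff_distrib sum_subtractf)

lemma matrix_diff_rdistrib: "((A::'a::ring_1^'n^'m) - B) ** C = A ** C - B ** C"
  by (simp add: matrix_matrix_mult_def vec_eq_iff left_diff_distrib sum_subtractf)

lemma matrix_neg_left: "- (A::'a::ring_1^'n^'m) ** B = - (A ** B)"
  by (simp add: matrix_matrix_mult_def vec_eq_iff sum_negf)

lemma matrix_neg_right: "(A::'a::ring_1^'n^'m) ** - B = - (A ** B)"
  by (simp add: matrix_matrix_mult_def vec_eq_iff sum_negf)

lemma matrix_scaleR_left: "(c *\<^sub>R A) ** (B::real^'n^'m) = c *\<^sub>R (A ** B)"
  by (simp add: scalar_matrix_assoc)

lemma matrix_scaleR_right: "(A::real^'n^'m) ** (c *\<^sub>R B) = c *\<^sub>R (A ** B)"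
  by (simp add: matrix_scalar_ac scalar_matrix_assoc)

lemmas matrix_ring_simps = matrix_add_ldistrib matrix_add_rdistrib matrix_diff_ldistrib
  matrix_diff_rdistrib matrix_neg_left matrix_neg_right matrix_scaleR_left matrix_scaleR_right

lemma transpose_add: "transpose ((A::'a::semiring_1^'n^'m) + B) = transpose A + transpose B"
  by (simp add: transpose_def vec_eq_iff)

lemma transpose_diff: "transpose ((A::'a::ring_1^'n^'m) - B) = transpose A - transpose B"
  by (simp add: transpose_def vec_eq_iff)

lemma trace_scaleR: "trace (c *\<^sub>R (A::real^'n^'n)) = c * trace A"
  by (simp add: trace_def sum_distrib_left)

lemma trace_transpose: "trace (transpose (A::'a::comm_semiring_1^'n^'n)) = trace A"
  by (simp add: trace_def transpose_def)

lemma trace_orthogonal_conj: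
  assumes "orthogonal_matrix (B::real^'n^'n)"
  shows "trace (transpose B ** A ** B) = trace A"
proof -
  have "trace (transpose B ** A ** B) = trace (A ** (B ** transpose B))"
    by (metis matrix_mul_assoc trace_mul_sym)
  then show ?thesis using assms by (simp add: orthogonal_matrix_def)
qed

lemma orthogonal_matrix_norm:
  assumes "orthogonal_matrix (A::real^'n^'n)"
  shows "norm (A *v x) = norm x"
  using assms by (simp add: orthogonal_transformation_matrix orthogonal_transformation_norm
      matrix_vector_mul_linear matrix_of_matrix_vector_mul)

lemmas mat3_entrywise = vec_eq_iff forall_3 sum_3 matrix_matrix_mult_def transpose_def trace_def
  inner_vec_def

lemma trace_mat1_3: "trace (mat 1 :: mat3) = 3"
  by (simp add: trace_I)

lemma SO3_orthogonal: "A \<in> SO3 \<Longrightarrow> orthogonal_matrix A"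
  by (simp add: SO3_def)

lemma SO3_transpose_mult: "A \<in> SO3 \<Longrightarrow> transpose A ** A = mat 1"
  and SO3_mult_transpose: "A \<in> SO3 \<Longrightarrow> A ** transpose A = mat 1"
  by (simp_all add: SO3_def orthogonal_matrix_def)

lemma SO3_id: "mat 1 \<in> SO3"
  by (simp add: SO3_def orthogonal_matrix_id)

lemma SO3_mult: "A \<in> SO3 \<Longrightarrow> B \<in> SO3 \<Longrightarrow> A ** B \<in> SO3"
  by (simp add: SO3_def orthogonal_matrix_mul det_mul)

lemma SO3_transpose: "A \<in> SO3 \<Longrightarrow> transpose A \<in> SO3"
  by (simp add: SO3_def det_transpose)

lemma mprod_SO3: "(\<forall>i\<in>{1..n}. Rt i \<in> SO3) \<Longrightarrow> k \<le> n \<Longrightarrow> mprod Rt k \<in> SO3"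
  by (induction k) (auto intro: SO3_mult simp: SO3_id)

section \<open>Rodrigues' formula\<close>

lemma skew_nth:
  "skew v $ 1 $ 1 = 0" "skew v $ 1 $ 2 = - v$3" "skew v $ 1 $ 3 = v$2"
  "skew v $ 2 $ 1 = v$3" "skew v $ 2 $ 2 = 0" "skew v $ 2 $ 3 = - v$1"
  "skew v $ 3 $ 1 = - v$2" "skew v $ 3 $ 2 = v$1" "skew v $ 3 $ 3 = 0"
  by (simp_all add: skew_def)

lemma skew_cube: "skew v ** skew v ** skew v = - ((v \<bullet> v) *\<^sub>R skew v)"
  by (simp add: mat3_entrywise skew_nth algebra_simps power2_eq_square)

lemma transpose_skew: "transpose (skew v) = - skew v"
  by (simp add: mat3_entrywise skew_nth)

lemma trace_skew: "trace (skew v) = 0"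
  by (simp add: mat3_entrywise skew_nth)

lemma trace_skew_square: "trace (skew v ** skew v) = - 2 * (v \<bullet> v)"
  by (simp add: mat3_entrywise skew_nth algebra_simps)

lemma skew_cube_unit: "norm v = 1 \<Longrightarrow> skew v ** skew v ** skew v = - skew v"
  by (simp add: skew_cube dot_square_norm)

definition rodrigues :: "mat3 \<Rightarrow> real \<Rightarrow> mat3" where
  "rodrigues K t = mat 1 + sin t *\<^sub>R K + (1 - cos t) *\<^sub>R (K ** K)"

lemma mpow_scaleR: "mpow (t *\<^sub>R K) k = t ^ k *\<^sub>R mpow K k"
  by (induction k) (simp_all add: matrix_scaleR_left matrix_scaleR_right mult.commute)

lemma mpow_cube_neg_coeffs:
  assumes K3: "K ** K ** K = - K"
  shows "mpow K k = (if k = 0 then 1 else 0) *\<^sub>R mat 1 + (fact k * sin_coeff k) *\<^sub>R K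
      + (fact k * ((if k = 0 then 1 else 0) - cos_coeff k)) *\<^sub>R (K ** K)"
proof (induction k)
  case 0
  then show ?case by (simp add: sin_coeff_def cos_coeff_def)
next
  case (Suc k)
  have sin_rec: "fact (Suc k) * sin_coeff (Suc k)
      = (if k = 0 then 1 else 0) - fact k * ((if k = 0 then 1 else 0) - cos_coeff k)"
    by (simp add: sin_coeff_Suc)
  have cos_rec: "fact (Suc k) * ((if Suc k = 0 then 1 else 0) - cos_coeff (Suc k))
      = (fact k * sin_coeff k :: real)"
    by (simp add: cos_coeff_Suc)
  have "mpow K (Suc k) = (if k = 0 then 1 else 0) *\<^sub>R K + (fact k * sin_coeff k) *\<^sub>R (K ** K)
      + (fact k * ((if k = 0 then 1 else 0) - cos_coeff k)) *\<^sub>R (K ** K ** K)"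
    by (simp add: Suc matrix_ring_simps matrix_mul_assoc)
  also have "\<dots> = ((if k = 0 then 1 else 0) - fact k * ((if k = 0 then 1 else 0) - cos_coeff k)) *\<^sub>R K
      + (fact k * sin_coeff k) *\<^sub>R (K ** K)"
    by (simp add: K3 algebra_simps)
  finally show ?case
    by (simp only: sin_rec cos_rec) simp
qed

text \<open>The exponential series collapses onto the span of \<open>I, K, K\<^sup>2\<close>,
  with the sine and cosine series as coefficients.\<close>

lemma mexp_rodrigues:
  assumes K3: "K ** K ** K = - K"
  shows "mexp (t *\<^sub>R K) = rodrigues K t"
proof -
  have term_eq: "(1 / fact k) *\<^sub>R mpow (t *\<^sub>R K) k =
     (if k = 0 then 1 else 0) *\<^sub>R mat 1 + (sin_coeff k * t ^ k) *\<^sub>R K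
     + ((if k = 0 then 1 else 0) - cos_coeff k * t ^ k) *\<^sub>R (K ** K)" for k
    by (cases "k = 0")
      (simp_all add: mpow_scaleR mpow_cube_neg_coeffs[OF K3] scaleR_add_right algebra_simps cos_coeff_def)
  have "(\<lambda>k. if k = 0 then 1 else 0 :: real) sums 1"
    using sums_single[of 0 "\<lambda>_. 1::real"] by simp
  moreover have "(\<lambda>k. sin_coeff k * t ^ k) sums sin t" "(\<lambda>k. cos_coeff k * t ^ k) sums cos t"
    using sin_converges[of t] cos_converges[of t] by simp_all
  ultimately have "(\<lambda>k. (1 / fact k) *\<^sub>R mpow (t *\<^sub>R K) k) sums
      ((1::real) *\<^sub>R mat 1 + sin t *\<^sub>R K + (1 - cos t) *\<^sub>R (K ** K))"
    unfolding term_eq by (intro sums_add sums_scaleR_left sums_diff)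
  then show ?thesis
    unfolding mexp_def rodrigues_def by (simp add: sums_unique[symmetric])
qed

lemma rodrigues_zero: "rodrigues K 0 = mat 1"
  by (simp add: rodrigues_def)

lemma rodrigues_add:
  assumes K3: "K ** K ** K = - K"
  shows "rodrigues K a ** rodrigues K b = rodrigues K (a + b)"
proof -
  have K4: "K ** K ** K ** K = - (K ** K)"
    by (simp add: K3 matrix_ring_simps)
  have "rodrigues K a ** rodrigues K b = mat 1
      + (sin a + sin b - sin a * (1 - cos b) - (1 - cos a) * sin b) *\<^sub>R K
      + ((1 - cos a) + (1 - cos b) + sin a * sin b - (1 - cos a) * (1 - cos b)) *\<^sub>R (K ** K)"
    unfolding rodrigues_def by (simp add: matrix_ring_simps matrix_mul_assoc K3 K4 algebra_simps)
  then show ?thesis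
    unfolding rodrigues_def by (simp add: sin_add cos_add algebra_simps)
qed

lemma mpow_rodrigues:
  "K ** K ** K = - K \<Longrightarrow> mpow (rodrigues K t) k = rodrigues K (real k * t)"
  by (induction k) (simp_all add: rodrigues_zero rodrigues_add algebra_simps)

lemma transpose_rodrigues_skew: "transpose (rodrigues (skew v) t) = rodrigues (skew v) (- t)"
  by (simp add: rodrigues_def transpose_add transpose_scalar matrix_transpose_mul transpose_skew
      matrix_ring_simps)

lemma trace_rodrigues_skew: "norm v = 1 \<Longrightarrow> trace (rodrigues (skew v) t) = 1 + 2 * cos t"
  by (simp add: rodrigues_def trace_add trace_sub trace_scaleR trace_mat1_3 trace_skew trace_skew_square
      dot_square_norm algebra_simps)

lemma rodrigues_skew_SO3:
  assumes "norm v = 1"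
  shows "rodrigues (skew v) t \<in> SO3"
proof -
  note add = rodrigues_add[OF skew_cube_unit[OF assms]]
  have orth: "orthogonal_matrix (rodrigues (skew v) s)" for s
    unfolding orthogonal_matrix_def transpose_rodrigues_skew add by (simp add: rodrigues_zero)
  have "rodrigues (skew v) t = rodrigues (skew v) (t/2) ** rodrigues (skew v) (t/2)"
    by (simp add: add)
  then have "det (rodrigues (skew v) t) = det (rodrigues (skew v) (t/2)) ^ 2"
    by (metis det_mul power2_eq_square)
  then have "det (rodrigues (skew v) t) \<ge> 0" by simp
  with det_orthogonal_matrix[OF orth] show ?thesis
    using orth unfolding SO3_def by force
qed

section \<open>The rotation angle\<close>

lemma cayley_hamilton_mat3:
  fixes A :: mat3
  shows "A ** (A ** A - trace A *\<^sub>R A + ((trace A ^ 2 - trace (A ** A)) / 2) *\<^sub>R mat 1)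
    = det A *\<^sub>R mat 1"
  by (simp add: mat3_entrywise mat_def det_3 algebra_simps power2_eq_square divide_simps)

lemma SO3_transpose_eq_poly:
  assumes "A \<in> SO3"
  shows "transpose A = A ** A - trace A *\<^sub>R A + trace A *\<^sub>R mat 1"
proof -
  define s where "s = (trace A ^ 2 - trace (A ** A)) / 2"
  have "transpose A = transpose A ** (A ** (A ** A - trace A *\<^sub>R A + s *\<^sub>R mat 1))"
    using cayley_hamilton_mat3[of A] assms by (simp add: s_def SO3_def)
  also have "\<dots> = A ** A - trace A *\<^sub>R A + s *\<^sub>R mat 1"
    by (simp add: matrix_mul_assoc SO3_transpose_mult[OF assms])
  finally have T: "transpose A = A ** A - trace A *\<^sub>R A + s *\<^sub>R mat 1" .
  then have "trace A = trace (A ** A) - trace A * trace A + 3 * s"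
    by (metis trace_transpose trace_add trace_sub trace_scaleR trace_mat1_3 mult.commute)
  then have "s = trace A"
    by (simp add: s_def power2_eq_square field_simps)
  with T show ?thesis by simp
qed

lemma SO3_trace_le: "A \<in> SO3 \<Longrightarrow> trace A \<le> 3"
proof -
  assume A: "A \<in> SO3"
  have "A $ i $ i \<le> 1" for i
  proof -
    have "\<bar>column i A $ i\<bar> \<le> norm (column i A)" by (rule component_le_norm_cart)
    moreover have "norm (column i A) = 1"
      using SO3_orthogonal[OF A] by (simp add: orthogonal_matrix_orthonormal_columns)
    ultimately show ?thesis by (simp add: column_def)
  qed
  from this[of 1] this[of 2] this[of 3] show ?thesis by (simp add: trace_def sum_3)
qed

text \<open>For a rotation by angle \<open>\<theta>\<close>, the symmetric matrix \<open>M\<close> below equals \<open>2 (1 - cos \<theta>)\<close> times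
  the projection onto the rotation axis; the two identities express exactly this.\<close>

lemma SO3_axis_form:
  assumes A: "A \<in> SO3"
  defines "M \<equiv> A + transpose A - (trace A - 1) *\<^sub>R mat 1"
  shows "M ** M = (3 - trace A) *\<^sub>R M" and "(A - mat 1) ** M = 0"
proof -
  have M: "M = A ** A + (1 - trace A) *\<^sub>R A + mat 1"
    unfolding M_def SO3_transpose_eq_poly[OF A] by (simp add: algebra_simps)
  have "mat 1 = A ** (A ** A - trace A *\<^sub>R A + trace A *\<^sub>R mat 1)"
    using SO3_mult_transpose[OF A] SO3_transpose_eq_poly[OF A] by simp
  then have A3: "A ** A ** A = mat 1 + trace A *\<^sub>R (A ** A) - trace A *\<^sub>R A"
    by (simp add: matrix_ring_simps matrix_mul_assoc algebra_simps)
  have AM: "A ** M = M"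
    unfolding M by (simp add: matrix_ring_simps matrix_mul_assoc A3 algebra_simps)
  then show "(A - mat 1) ** M = 0"
    by (simp add: matrix_diff_rdistrib)
  have MA: "M ** A = M"
    using AM unfolding M by (simp add: matrix_ring_simps matrix_mul_assoc)
  have "M ** M = M ** (A ** A) + (1 - trace A) *\<^sub>R (M ** A) + M"
    by (subst (2) M) (simp add: matrix_ring_simps)
  also have "\<dots> = (3 - trace A) *\<^sub>R M"
    by (simp add: matrix_mul_assoc MA) (simp add: vec_eq_iff algebra_simps)
  finally show "M ** M = (3 - trace A) *\<^sub>R M" .
qed

lemma inner_matrix_sym_part:
  fixes A :: "real^'n^'n"
  shows "v \<bullet> ((A + transpose A - c *\<^sub>R mat 1) *v v) = 2 * (v \<bullet> (A *v v)) - c * (v \<bullet> v)"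
proof -
  have "v \<bullet> (transpose A *v v) = v \<bullet> (A *v v)"
    by (metis dot_lmul_matrix inner_commute transpose_matrix_vector)
  then show ?thesis
    by (simp add: matrix_vector_mult_add_rdistrib matrix_vector_mult_diff_rdistrib
        inner_add_right inner_diff_right scaleR_matrix_vector_assoc[symmetric])
qed

lemma SO3_inner_ge:
  assumes A: "A \<in> SO3" and v: "norm v = 1"
  shows "(trace A - 1) / 2 \<le> v \<bullet> (A *v v)"
proof -
  define M where "M = A + transpose A - (trace A - 1) *\<^sub>R mat 1"
  have vMv: "v \<bullet> (M *v v) = 2 * (v \<bullet> (A *v v)) - (trace A - 1)"
    using v by (simp add: M_def inner_matrix_sym_part dot_square_norm)
  have "transpose M = M"
    by (simp add: M_def transpose_add transpose_diff transpose_scalar)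
  have "(3 - trace A) * (v \<bullet> (M *v v)) = v \<bullet> (M *v (M *v v))"
    by (simp add: matrix_vector_mul_assoc SO3_axis_form(1)[OF A, folded M_def]
        scaleR_matrix_vector_assoc[symmetric])
  also have "\<dots> = (M *v v) \<bullet> (M *v v)"
    by (metis \<open>transpose M = M\<close> dot_lmul_matrix transpose_matrix_vector)
  finally have prod: "(3 - trace A) * (v \<bullet> (M *v v)) = (M *v v) \<bullet> (M *v v)" .
  have "v \<bullet> (M *v v) \<ge> 0"
  proof (cases "trace A = 3")
    case True
    then show ?thesis using prod by simp
  next
    case False
    then have "3 - trace A > 0" using SO3_trace_le[OF A] by simp
    then show ?thesis using prod by (metis inner_ge_zero zero_le_mult_iff not_less)
  qed
  then show ?thesis using vMv by simp
qed

lemma SO3_inner_attains: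
  assumes A: "A \<in> SO3"
  obtains v where "norm v = 1" "v \<bullet> (A *v v) = (trace A - 1) / 2"
proof -
  define M where "M = A + transpose A - (trace A - 1) *\<^sub>R mat 1"
  have "\<not> invertible M"
  proof
    assume "invertible M"
    then obtain M' where M': "M ** M' = mat 1"
      unfolding invertible_def by blast
    then have "A - mat 1 = (A - mat 1) ** M ** M'"
      by (simp add: matrix_mul_assoc[symmetric])
    then have "A = mat 1"
      using SO3_axis_form(2)[OF A, folded M_def] by simp
    then have "M = 0"
      by (simp add: M_def trace_mat1_3 scaleR_2)
    with M' have "(mat 1 :: mat3) $ 1 $ 1 = 0"
      by simp
    then show False
      by (simp add: mat_def)
  qed
  then obtain w where w: "w \<noteq> 0" "M *v w = 0"
    unfolding invertible_left_inverse matrix_left_invertible_ker by blast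
  define v where "v = (1 / norm w) *\<^sub>R w"
  have nv: "norm v = 1" using w by (simp add: v_def)
  have "M *v v = 0" by (simp add: v_def matrix_vector_mult_scaleR w)
  moreover have "v \<bullet> (M *v v) = 2 * (v \<bullet> (A *v v)) - (trace A - 1)"
    using nv by (simp add: M_def inner_matrix_sym_part dot_square_norm)
  ultimately have "2 * (v \<bullet> (A *v v)) - (trace A - 1) = 0"
    by simp
  with nv that show ?thesis by simp
qed

lemma SO3_trace_ge: "A \<in> SO3 \<Longrightarrow> -1 \<le> trace A"
proof -
  assume A: "A \<in> SO3"
  obtain v where v: "norm v = 1" "v \<bullet> (A *v v) = (trace A - 1) / 2"
    using SO3_inner_attains[OF A] .
  have "\<bar>v \<bullet> (A *v v)\<bar> \<le> norm v * norm (A *v v)" by (rule Cauchy_Schwarz_ineq2)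
  then show ?thesis
    using v orthogonal_matrix_norm[OF SO3_orthogonal[OF A], of v] by simp
qed

definition rot_angle :: "mat3 \<Rightarrow> real" where
  "rot_angle A = arccos ((trace A - 1) / 2)"

lemma rot_angle_bounds: "A \<in> SO3 \<Longrightarrow> 0 \<le> rot_angle A \<and> rot_angle A \<le> pi"
  unfolding rot_angle_def using SO3_trace_ge[of A] SO3_trace_le[of A] by (intro arccos_bounded) auto

lemma trace_eq_cos_rot_angle: "A \<in> SO3 \<Longrightarrow> trace A = 1 + 2 * cos (rot_angle A)"
  unfolding rot_angle_def using SO3_trace_ge[of A] SO3_trace_le[of A] by (simp add: cos_arccos field_simps)

lemma rot_angle_id: "rot_angle (mat 1) = 0"
  by (simp add: rot_angle_def trace_mat1_3)

lemma unit_inner_bounds: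
  fixes x y :: "'a::real_inner"
  assumes "norm x = 1" "norm y = 1"
  shows "-1 \<le> x \<bullet> y" "x \<bullet> y \<le> 1"
  using Cauchy_Schwarz_ineq2[of x y] assms by auto

lemma arccos_inner_le_rot_angle:
  assumes A: "A \<in> SO3" and v: "norm v = 1"
  shows "arccos (v \<bullet> (A *v v)) \<le> rot_angle A"
  unfolding rot_angle_def
  using SO3_inner_ge[OF A v] SO3_trace_ge[OF A] unit_inner_bounds[OF v, of "A *v v"]
    orthogonal_matrix_norm[OF SO3_orthogonal[OF A], of v] v
  by (intro arccos_le_arccos) auto

text \<open>By the law of cosines this reduces to Cauchy--Schwarz for the components of \<open>x\<close> and
  \<open>z\<close> orthogonal to \<open>y\<close>.\<close>

lemma arccos_inner_triangle:
  fixes x y z :: "'a::real_inner"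
  assumes nx: "norm x = 1" and ny: "norm y = 1" and nz: "norm z = 1"
  shows "arccos (x \<bullet> z) \<le> arccos (x \<bullet> y) + arccos (y \<bullet> z)"
proof -
  define a where "a = x \<bullet> y"
  define b where "b = y \<bullet> z"
  have ab: "-1 \<le> a" "a \<le> 1" "-1 \<le> b" "b \<le> 1"
    using unit_inner_bounds[OF nx ny] unit_inner_bounds[OF ny nz] by (simp_all add: a_def b_def)
  have xz: "-1 \<le> x \<bullet> z" "x \<bullet> z \<le> 1" using unit_inner_bounds[OF nx nz] by simp_all
  define S where "S = arccos a + arccos b"
  show ?thesis
  proof (cases "S \<le> pi")
    case False
    then show ?thesis using arccos_bounded[OF xz] by (simp add: S_def a_def b_def)
  next
    case True
    have xx: "x \<bullet> x = 1" and yy: "y \<bullet> y = 1" and zz: "z \<bullet> z = 1"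
      using nx ny nz by (simp_all add: dot_square_norm)
    define x' where "x' = x - a *\<^sub>R y"
    define z' where "z' = z - b *\<^sub>R y"
    have "x \<bullet> z = x' \<bullet> z' + a * b"
      unfolding x'_def z'_def
      by (simp add: inner_diff_left inner_diff_right yy a_def b_def inner_commute algebra_simps)
    moreover have "norm x' = sqrt (1 - a\<^sup>2)" "norm z' = sqrt (1 - b\<^sup>2)"
      unfolding x'_def z'_def norm_eq_sqrt_inner
      by (simp_all add: inner_diff_left inner_diff_right xx yy zz a_def b_def inner_commute
          algebra_simps power2_eq_square)
    then have "- (sqrt (1 - a\<^sup>2) * sqrt (1 - b\<^sup>2)) \<le> x' \<bullet> z'"
      using Cauchy_Schwarz_ineq2[of x' z'] by (simp add: abs_le_iff)
    moreover have "cos S = a * b - sqrt (1 - a\<^sup>2) * sqrt (1 - b\<^sup>2)"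
      unfolding S_def cos_add using ab by (simp add: cos_arccos sin_arccos)
    ultimately have "cos S \<le> x \<bullet> z" by linarith
    then have "arccos (x \<bullet> z) \<le> arccos (cos S)"
      using xz by (intro arccos_le_arccos) auto
    also have "\<dots> = S"
      using True ab by (simp add: S_def arccos_cos arccos_lbound add_nonneg_nonneg)
    finally show ?thesis by (simp add: S_def a_def b_def)
  qed
qed

lemma rot_angle_mult_le:
  assumes A: "A \<in> SO3" and B: "B \<in> SO3"
  shows "rot_angle (A ** B) \<le> rot_angle A + rot_angle B"
proof -
  obtain v where v: "norm v = 1" "v \<bullet> ((A ** B) *v v) = (trace (A ** B) - 1) / 2"
    using SO3_inner_attains[OF SO3_mult[OF A B]] .
  define y where "y = B *v v"
  have ny: "norm y = 1"
    using orthogonal_matrix_norm[OF SO3_orthogonal[OF B]] v by (simp add: y_def)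
  have nAy: "norm (A *v y) = 1"
    using orthogonal_matrix_norm[OF SO3_orthogonal[OF A]] ny by simp
  have "rot_angle (A ** B) = arccos (v \<bullet> (A *v y))"
    unfolding rot_angle_def v(2)[symmetric] by (simp add: y_def matrix_vector_mul_assoc)
  also have "\<dots> \<le> arccos (v \<bullet> y) + arccos (y \<bullet> (A *v y))"
    by (rule arccos_inner_triangle[OF v(1) ny nAy])
  also have "\<dots> \<le> rot_angle B + rot_angle A"
    using arccos_inner_le_rot_angle[OF B v(1)] arccos_inner_le_rot_angle[OF A ny]
    by (simp add: y_def)
  finally show ?thesis by simp
qed

lemma rot_angle_mprod_le:
  assumes Q: "\<forall>i\<in>{1..n}. Q i \<in> SO3"
  shows "rot_angle (mprod Q n) \<le> (\<Sum>i=1..n. rot_angle (Q i))"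
proof -
  have "k \<le> n \<Longrightarrow> rot_angle (mprod Q k) \<le> (\<Sum>i=1..k. rot_angle (Q i))" for k
  proof (induction k)
    case 0
    then show ?case by (simp add: rot_angle_id)
  next
    case (Suc k)
    have "rot_angle (mprod Q k ** Q (Suc k)) \<le> rot_angle (mprod Q k) + rot_angle (Q (Suc k))"
      using Suc.prems Q by (intro rot_angle_mult_le mprod_SO3[OF Q]) simp_all
    with Suc show ?case by simp
  qed
  then show ?thesis by simp
qed

section \<open>A trigonometric inequality\<close>

lemma cos_ge_one_minus_square_half: "1 - x\<^sup>2 / 2 \<le> cos (x::real)"
proof -
  have "\<bar>sin (x/2)\<bar>\<^sup>2 \<le> \<bar>x/2\<bar>\<^sup>2"
    using abs_sin_x_le_abs_x[of "x/2"] by (intro power_mono) auto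
  then show ?thesis
    using cos_double_sin[of "x/2"] by (simp add: power_divide)
qed

lemma cos_le_tangent:
  assumes m0: "0 \<le> m" and m1: "m \<le> pi/2" and x0: "0 \<le> x" and x1: "x \<le> pi - m"
  shows "cos x \<le> cos m - sin m * (x - m)"
proof (cases x m rule: linorder_cases)
  case less
  obtain z where z: "x < z" "z < m" "cos m - cos x = (m - x) * (- sin z)"
    using MVT2[OF less, of cos "\<lambda>t. - sin t"] by (auto intro: derivative_eq_intros)
  have "sin z \<le> sin m" using z m1 x0 by (intro sin_monotone_2pi_le) auto
  then have "(m - x) * sin z \<le> (m - x) * sin m" using less by (intro mult_left_mono) auto
  then show ?thesis using z by (simp add: algebra_simps)
next
  case equal
  then show ?thesis by simp
next
  case greater
  obtain z where z: "m < z" "z < x" "cos x - cos m = (x - m) * (- sin z)"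
    using MVT2[OF greater, of cos "\<lambda>t. - sin t"] by (auto intro: derivative_eq_intros)
  have "sin m \<le> sin z"
  proof (cases "z \<le> pi/2")
    case True
    then show ?thesis using z m0 by (intro sin_monotone_2pi_le) auto
  next
    case False
    have "sin m \<le> sin (pi - z)" using z x1 False m0 by (intro sin_monotone_2pi_le) auto
    then show ?thesis by simp
  qed
  then have "(x - m) * sin m \<le> (x - m) * sin z" using greater by (intro mult_left_mono) auto
  then show ?thesis using z by (simp add: algebra_simps)
qed

lemma cos_pi_div_ge:
  fixes n :: nat
  assumes "n \<ge> 3"
  shows "real n - 1 \<le> (real n + 1) * cos (pi / real n)"
proof -
  consider "n = 3" | "n = 4" | "n \<ge> 5" using assms by linarith
  then show ?thesis
  proof cases
    case 1
    then show ?thesis by (simp add: cos_60)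
  next
    case 2
    have "6/5 \<le> sqrt (2::real)" by (rule real_le_rsqrt) (simp add: power2_eq_square)
    then show ?thesis using 2 by (simp add: cos_45)
  next
    case 3
    then have n5: "real n \<ge> 5" by simp
    have "pi\<^sup>2 \<le> (4::real)\<^sup>2" using pi_less_4 by (intro power_mono) auto
    then have "(real n + 1) * pi\<^sup>2 \<le> (real n + 1) * 4\<^sup>2" by (intro mult_left_mono) auto
    also have "\<dots> = 4 * (4 * (real n + 1))" by simp
    also have "4 * (real n + 1) \<le> 5 * real n" using n5 by simp
    also have "5 * real n \<le> real n * real n" using n5 by (intro mult_right_mono) auto
    finally have "(real n + 1) * pi\<^sup>2 \<le> 4 * (real n)\<^sup>2" by (simp add: power2_eq_square)
    then have "real n - 1 \<le> (real n + 1) * (1 - (pi / real n)\<^sup>2 / 2)"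
      using n5 by (simp add: power_divide field_simps)
    also have "\<dots> \<le> (real n + 1) * cos (pi / real n)"
      by (intro mult_left_mono cos_ge_one_minus_square_half) auto
    finally show ?thesis .
  qed
qed

text \<open>If every angle stays below \<open>\<pi> - g/n\<close>, the tangent line of \<open>cos\<close> at \<open>g/n\<close> gives the
  bound; otherwise one angle contributes at most \<open>-cos (g/n)\<close>, and \<open>n \<ge> 3\<close> makes this small
  enough.\<close>

lemma sum_cos_le_cos_mean:
  fixes n :: nat and \<theta> :: "nat \<Rightarrow> real" and g :: real
  assumes n3: "n \<ge> 3" and \<theta>: "\<forall>i\<in>{1..n}. 0 \<le> \<theta> i \<and> \<theta> i \<le> pi"
    and g0: "0 \<le> g" and gpi: "g \<le> pi" and g_le: "g \<le> (\<Sum>i=1..n. \<theta> i)"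
  shows "(\<Sum>i=1..n. cos (\<theta> i)) \<le> real n * cos (g / real n)"
proof -
  define m where "m = g / real n"
  have npos: "real n > 0" using n3 by simp
  have m0: "0 \<le> m" using g0 npos by (simp add: m_def)
  have m_le: "m \<le> pi / real n" using gpi npos by (simp add: m_def divide_right_mono)
  also have "pi / real n \<le> pi / 3" using n3 by (intro divide_left_mono) auto
  finally have m3: "m \<le> pi / 3" .
  show ?thesis
  proof (cases "\<forall>i\<in>{1..n}. \<theta> i \<le> pi - m")
    case True
    have "(\<Sum>i=1..n. cos (\<theta> i)) \<le> (\<Sum>i=1..n. cos m - sin m * (\<theta> i - m))"
      using True \<theta> m0 m3 by (intro sum_mono cos_le_tangent) auto
    also have "\<dots> = real n * cos m - sin m * ((\<Sum>i=1..n. \<theta> i) - g)"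
      using npos by (simp add: sum_subtractf sum_distrib_left m_def algebra_simps)
    also have "\<dots> \<le> real n * cos m"
      using g_le m0 m3 sin_ge_zero[of m] by simp
    finally show ?thesis by (simp add: m_def)
  next
    case False
    then obtain j where j: "j \<in> {1..n}" "\<theta> j > pi - m" by auto
    have "cos (\<theta> j) \<le> cos (pi - m)"
      using j \<theta> m3 m0 by (intro cos_monotone_0_pi_le) auto
    then have cj: "cos (\<theta> j) \<le> - cos m" by simp
    have "(\<Sum>i=1..n. cos (\<theta> i)) = cos (\<theta> j) + (\<Sum>i\<in>{1..n} - {j}. cos (\<theta> i))"
      using j by (simp add: sum.remove)
    also have "(\<Sum>i\<in>{1..n} - {j}. cos (\<theta> i)) \<le> (\<Sum>i\<in>{1..n} - {j}. 1)"
      by (intro sum_mono) simp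
    also have "(\<Sum>i\<in>{1..n} - {j}. 1::real) = real n - 1"
      using j by (simp add: card_Diff_singleton of_nat_diff)
    finally have "(\<Sum>i=1..n. cos (\<theta> i)) \<le> real n - 1 - cos m" using cj by linarith
    moreover have "cos (pi / real n) \<le> cos m"
      using m0 m_le npos by (intro cos_monotone_0_pi_le) (auto simp: divide_le_eq)
    then have "real n - 1 \<le> (real n + 1) * cos m"
      using cos_pi_div_ge[OF n3] mult_left_mono[of "cos (pi / real n)" "cos m" "real n + 1"]
      by linarith
    ultimately show ?thesis by (simp add: m_def algebra_simps)
  qed
qed

section \<open>The cost on the cycle graph\<close>

definition cyc_next :: "nat \<Rightarrow> nat \<Rightarrow> nat" where
  "cyc_next n i = (if i = n then 1 else Suc i)"

definition cyc_prev :: "nat \<Rightarrow> nat \<Rightarrow> nat" where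
  "cyc_prev n i = (if i = 1 then n else i - 1)"

definition edge_residual :: "nat \<Rightarrow> (nat \<Rightarrow> mat3) \<Rightarrow> (nat \<Rightarrow> mat3) \<Rightarrow> nat \<Rightarrow> mat3" where
  "edge_residual n Rt R i = transpose (R i) ** Rt i ** R (cyc_next n i)"

lemma cyc_next_in: "n \<ge> 1 \<Longrightarrow> i \<in> {1..n} \<Longrightarrow> cyc_next n i \<in> {1..n}"
  by (auto simp: cyc_next_def)

lemma cyc_next_prev: "i \<in> {1..n} \<Longrightarrow> cyc_next n (cyc_prev n i) = i"
  by (auto simp: cyc_next_def cyc_prev_def)

lemma bij_betw_cyc_prev: "n \<ge> 1 \<Longrightarrow> bij_betw (cyc_prev n) {1..n} {1..n}"
  by (rule bij_betwI[where g = "cyc_next n"]) (auto simp: cyc_next_def cyc_prev_def)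

lemma edge_residual_SO3:
  assumes "n \<ge> 1" "\<forall>i\<in>{1..n}. Rt i \<in> SO3" "\<forall>i\<in>{1..n}. R i \<in> SO3" "i \<in> {1..n}"
  shows "edge_residual n Rt R i \<in> SO3"
  using assms cyc_next_in[OF assms(1,4)]
  by (auto simp: edge_residual_def intro!: SO3_mult SO3_transpose)

lemma cost_row_sum:
  assumes n3: "n \<ge> 3" and i: "i \<in> {1..n}"
  shows "(\<Sum>j\<in>{1..n}. trace (transpose (R i) ** block n Rt i j ** R j)) =
     trace (transpose (R i) ** R i) + trace (edge_residual n Rt R i)
     + trace (transpose (R i) ** transpose (Rt (cyc_prev n i)) ** R (cyc_prev n i))"
proof -
  let ?g = "\<lambda>j. trace (transpose (R i) ** block n Rt i j ** R j)"
  let ?N = "{i, cyc_next n i, cyc_prev n i}"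
  have N: "?N \<subseteq> {1..n}" using i n3 by (auto simp: cyc_next_def cyc_prev_def)
  have distinct: "i \<noteq> cyc_next n i" "i \<noteq> cyc_prev n i" "cyc_next n i \<noteq> cyc_prev n i"
    using i n3 by (auto simp: cyc_next_def cyc_prev_def)
  have "?g j = 0" if "j \<in> {1..n} - ?N" for j
  proof -
    have "\<not> cyc_adj n i j" "j \<noteq> i"
      using that i n3 by (auto simp: cyc_adj_def cyc_next_def cyc_prev_def split: if_splits)
    then show ?thesis by (simp add: block_def trace_0[unfolded mat_0])
  qed
  then have "(\<Sum>j\<in>{1..n}. ?g j) = (\<Sum>j\<in>?N. ?g j)"
    by (intro sum.mono_neutral_right N) auto
  also have "\<dots> = ?g i + ?g (cyc_next n i) + ?g (cyc_prev n i)"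
    using distinct by (simp add: algebra_simps)
  also have "block n Rt i (cyc_next n i) = Rt i"
    using i n3 distinct by (auto simp: block_def cyc_adj_def meas_def cyc_next_def)
  also have "block n Rt i (cyc_prev n i) = transpose (Rt (cyc_prev n i))"
    using i n3 distinct by (auto simp: block_def cyc_adj_def meas_def cyc_prev_def)
  finally show ?thesis by (simp add: block_def edge_residual_def)
qed

text \<open>The edge \<open>(cyc_prev n i, i)\<close> is counted twice, once from each endpoint, with transposed
  (hence equal-trace) contributions.\<close>

lemma cost_eq_edge_sum:
  assumes n3: "n \<ge> 3" and R: "\<forall>i\<in>{1..n}. R i \<in> SO3"
  shows "cost n Rt R = - (3 * real n + 2 * (\<Sum>i=1..n. trace (edge_residual n Rt R i)))"
proof -
  let ?f = "\<lambda>i. trace (edge_residual n Rt R i)"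
  have "trace (transpose (R i) ** transpose (Rt (cyc_prev n i)) ** R (cyc_prev n i))
      = ?f (cyc_prev n i)" if "i \<in> {1..n}" for i
    using cyc_next_prev[OF that] trace_transpose
    by (metis edge_residual_def matrix_transpose_mul matrix_mul_assoc transpose_transpose)
  then have reversed: "(\<Sum>i=1..n. trace (transpose (R i) ** transpose (Rt (cyc_prev n i)) ** R (cyc_prev n i)))
      = (\<Sum>i=1..n. ?f i)"
    using sum.reindex_bij_betw[OF bij_betw_cyc_prev, of n ?f] n3 by simp
  have diag: "(\<Sum>i=1..n. trace (transpose (R i) ** R i)) = 3 * real n"
    using R by (simp add: SO3_transpose_mult trace_mat1_3)
  have "cost n Rt R = - (\<Sum>i=1..n. trace (transpose (R i) ** R i) + ?f i
      + trace (transpose (R i) ** transpose (Rt (cyc_prev n i)) ** R (cyc_prev n i)))"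
    unfolding cost_def using cost_row_sum[OF n3] by (intro arg_cong[where f=uminus] sum.cong) auto
  then show ?thesis
    unfolding sum.distrib diag reversed by simp
qed

lemma mprod_edge_residual:
  assumes n3: "n \<ge> 3" and R: "\<forall>i\<in>{1..n}. R i \<in> SO3"
  shows "k \<le> n \<Longrightarrow> mprod (edge_residual n Rt R) k
      = transpose (R 1) ** mprod Rt k ** R (if k = n then 1 else Suc k)"
proof (induction k)
  case 0
  then show ?case using R n3 by (simp add: SO3_transpose_mult)
next
  case (Suc k)
  have cancel: "X ** R j ** transpose (R j) = X" if "j \<in> {1..n}" for X j
    using R that by (simp add: SO3_mult_transpose flip: matrix_mul_assoc)
  show ?case
    using Suc n3 by (simp add: edge_residual_def cyc_next_def matrix_mul_assoc cancel)
qed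

lemma sum_trace_edge_residual_le:
  assumes n3: "n \<ge> 3" and Rt: "\<forall>i\<in>{1..n}. Rt i \<in> SO3" and R: "\<forall>i\<in>{1..n}. R i \<in> SO3"
    and \<gamma>: "\<gamma> \<in> {-pi..pi}" and E: "trace (mprod Rt n) = 1 + 2 * cos \<gamma>"
  shows "(\<Sum>i=1..n. trace (edge_residual n Rt R i)) \<le> real n * (1 + 2 * cos (\<gamma> / real n))"
proof -
  let ?Q = "edge_residual n Rt R"
  have Q: "\<forall>i\<in>{1..n}. ?Q i \<in> SO3"
    using n3 Rt R by (auto intro: edge_residual_SO3)
  have R1: "orthogonal_matrix (R 1)" using R n3 by (auto intro: SO3_orthogonal)
  have "trace (mprod ?Q n) = 1 + 2 * cos \<gamma>"
    using mprod_edge_residual[OF n3 R, of n] trace_orthogonal_conj[OF R1] E by simp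
  then have "rot_angle (mprod ?Q n) = \<bar>\<gamma>\<bar>"
    using \<gamma> by (simp add: rot_angle_def arccos_cos_eq_abs abs_le_iff)
  then have "\<bar>\<gamma>\<bar> \<le> (\<Sum>i=1..n. rot_angle (?Q i))"
    using rot_angle_mprod_le[OF Q] by simp
  then have "(\<Sum>i=1..n. cos (rot_angle (?Q i))) \<le> real n * cos (\<bar>\<gamma>\<bar> / real n)"
    using Q rot_angle_bounds \<gamma> by (intro sum_cos_le_cos_mean[OF n3]) auto
  also have "cos (\<bar>\<gamma>\<bar> / real n) = cos (\<gamma> / real n)"
    by (simp add: abs_if)
  finally have "(\<Sum>i=1..n. cos (rot_angle (?Q i))) \<le> real n * cos (\<gamma> / real n)" .
  moreover have "(\<Sum>i=1..n. trace (?Q i)) = real n + 2 * (\<Sum>i=1..n. cos (rot_angle (?Q i)))"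
    using Q by (simp add: trace_eq_cos_rot_angle sum.distrib sum_distrib_left)
  ultimately show ?thesis by (simp add: algebra_simps)
qed

lemma edge_residual_even_spread:
  assumes v: "norm v = 1" and Rt: "\<forall>i\<in>{1..n}. Rt i \<in> SO3"
    and E: "mprod Rt n = rodrigues (skew v) \<gamma>" and i: "i \<in> {1..n}"
  defines "R \<equiv> \<lambda>i. transpose (mprod Rt (i - 1)) ** rodrigues (skew v) (real (i - 1) * (\<gamma> / real n))"
  shows "edge_residual n Rt R i = rodrigues (skew v) (\<gamma> / real n)"
proof -
  define \<alpha> where "\<alpha> = \<gamma> / real n"
  note rot_add = rodrigues_add[OF skew_cube_unit[OF v]]
  obtain j where j: "i = Suc j" using i by (cases i) auto
  have "transpose (R i) ** Rt i = rodrigues (skew v) (- (real j * \<alpha>)) ** mprod Rt i"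
    by (simp add: R_def j \<alpha>_def matrix_transpose_mul transpose_rodrigues_skew matrix_mul_assoc)
  then have residual: "edge_residual n Rt R i
      = rodrigues (skew v) (- (real j * \<alpha>)) ** (mprod Rt i ** R (cyc_next n i))"
    by (simp add: edge_residual_def matrix_mul_assoc)
  have "rodrigues (skew v) (- (real j * \<alpha>)) ** (mprod Rt i ** R (cyc_next n i))
      = rodrigues (skew v) \<alpha>"
  proof (cases "i = n")
    case True
    have "\<gamma> = real n * \<alpha>" using i by (simp add: \<alpha>_def)
    moreover have "real n = real j + 1" using True j by simp
    ultimately have "- (real j * \<alpha>) + \<gamma> = \<alpha>" by (simp add: algebra_simps)
    then show ?thesis
      using True by (simp add: R_def cyc_next_def E rodrigues_zero rot_add)
  next
    case False
    have "mprod Rt i ** transpose (mprod Rt i) = mat 1"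
      using i by (intro SO3_mult_transpose mprod_SO3[OF Rt]) auto
    then have "mprod Rt i ** R (cyc_next n i) = rodrigues (skew v) (real i * \<alpha>)"
      using False by (simp add: R_def cyc_next_def \<alpha>_def matrix_mul_assoc)
    moreover have "- (real j * \<alpha>) + real i * \<alpha> = \<alpha>" by (simp add: j algebra_simps)
    ultimately show ?thesis by (simp add: rot_add)
  qed
  then show ?thesis
    by (simp add: residual \<alpha>_def)
qed

theorem theorem2:
  fixes n :: nat and Rt :: "nat \<Rightarrow> mat3" and nhat :: "real^3" and \<gamma> :: real
  assumes "n \<ge> 3"
    and "\<forall>i\<in>{1..n}. Rt i \<in> SO3"
    and "norm nhat = 1" and "\<gamma> \<in> {-pi..pi}"
    and "cycle_err n Rt = mexp (\<gamma> *\<^sub>R skew nhat)"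
  shows "let E0 = mexp ((\<gamma> / real n) *\<^sub>R skew nhat);
             Rstar = (\<lambda>i. transpose (mprod Rt (i - 1)) ** mpow E0 (i - 1))
         in (\<forall>i\<in>{1..n}. Rstar i \<in> SO3) \<and>
            (\<forall>R. (\<forall>i\<in>{1..n}. R i \<in> SO3) \<longrightarrow> cost n Rt Rstar \<le> cost n Rt R)"
proof -
  note n3 = assms(1) and Rt = assms(2) and v = assms(3) and K3 = skew_cube_unit[OF assms(3)]
  define Rs where "Rs i = transpose (mprod Rt (i - 1)) ** rodrigues (skew nhat) (real (i - 1) * (\<gamma> / real n))" for i
  have E: "mprod Rt n = rodrigues (skew nhat) \<gamma>"
    using assms(5) by (simp add: cycle_err_def mexp_rodrigues[OF K3])
  have Rs_SO3: "\<forall>i\<in>{1..n}. Rs i \<in> SO3"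
    by (auto simp: Rs_def intro!: SO3_mult SO3_transpose mprod_SO3[OF Rt] rodrigues_skew_SO3[OF v])
  have "cost n Rt Rs = - (3 * real n + 2 * (real n * (1 + 2 * cos (\<gamma> / real n))))"
    using edge_residual_even_spread[OF v Rt E]
    by (simp add: cost_eq_edge_sum[OF n3 Rs_SO3] Rs_def trace_rodrigues_skew[OF v])
  then have Rs_min: "cost n Rt Rs \<le> cost n Rt R" if R: "\<forall>i\<in>{1..n}. R i \<in> SO3" for R
    using sum_trace_edge_residual_le[OF n3 Rt R assms(4)]
    by (simp add: cost_eq_edge_sum[OF n3 R] E trace_rodrigues_skew[OF v])
  have Rstar_eq: "transpose (mprod Rt (i - 1)) ** mpow (mexp ((\<gamma> / real n) *\<^sub>R skew nhat)) (i - 1) = Rs i" for i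
    by (simp add: Rs_def mexp_rodrigues[OF K3] mpow_rodrigues[OF K3])
  show ?thesis
    unfolding Let_def Rstar_eq using Rs_SO3 Rs_min by blast
qed

end
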